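(* Let $V$ be a euclidean space of dimension $n\ge 2$, let $c:[a,b]\to V$ be a regular curve, and let $\kappa_1,\dots,\kappa_{n-1}$ be its curvatures. Then the following identities hold at every $t\in[a,b]$. 1. For $1\le r\le n-2$, $$\kappa_r=\frac{\mathrm{vol}(c',\dots,c^{(r-1)})\,\mathrm{vol}(c',\dots,c^{(r+1)})}{\mathrm{vol}(c',\dots,c^{(r)})^2}\,\|c'\|^{-1}.$$ 2. For the top curvature (the torsion), $$\kappa_{n-1}=\frac{\mathrm{vol}(c',\dots,c^{(n-2)})\,\det(c',\dots,c^{(n)})}{\mathrm{vol}(c',\dots,c^{(n-1)})^2}\,\|c'\|^{-1}.$$
   Context: A euclidean space is a finite-dimensional, oriented, real vector space $V$ with a positive definite scalar product $\langle\cdot,\cdot\rangle$. A regular curve in $V$ ($\dim V=n$) is a map $c:[a,b]\to V$, $a<b$, which is differentiable as many times as needed and such that $c'(t),\dots,c^{(n-1)}(t)$ are linearly independent for every $t\in[a,b]$. $\mathrm{vol}(v_1,\dots,v_k)$ is the $k$-dimensional volume of the parallelepiped spanned by $v_1,\dots,v_k\in V$, i.e. the square root of the Gram determinant $\det(\langle v_i,v_j\rangle)$; the volume of the empty collection is $1$. $\det(v_1,\dots,v_n)$ is the determinant of the matrix of coordinates of $v_1,\dots,v_n$ in any positive orthonormal basis of $V$. Frenet-Serret frame $e(t)=(e_1(t),\dots,e_n(t))$: $e_1,\dots,e_{n-1}$ is the Gram-Schmidt orthonormalization of $c',\dots,c^{(n-1)}$ (so $e_i$ is a linear combination of $c',\dots,c^{(i)}$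 with positive coefficient at $c^{(i)}$), and $e_n$ is the unique vector making $e_1,\dots,e_n$ a positive orthonormal basis. The curvatures $\kappa_1,\dots,\kappa_{n-1}$ are the functions determined by the Frenet-Serret equation $e_i'=\|c'\|\,(-\kappa_{i-1}e_{i-1}+\kappa_i e_{i+1})$, $1\le i\le n$ (with the convention that terms involving $e_0$ or $e_{n+1}$ are absent); equivalently $\kappa_r=\langle e_r',e_{r+1}\rangle/\|c'\|$. *)

theory Defs
  imports "HOL-Analysis.Analysis" "Jordan_Normal_Form.Determinant"
begin

text \<open>
  A euclidean space is a type of class \<open>euclidean_space\<close> together with an explicitly given
  orientation; the distinguished set \<open>Basis\<close> of that class is used only for the dimension.
  Ordered families of vectors are lists.
\<close>

definition list_independent :: "'a::real_vector list \<Rightarrow> bool" where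
  "list_independent vs \<longleftrightarrow> distinct vs \<and> independent (set vs)"

definition ordered_basis :: "'a::euclidean_space list \<Rightarrow> bool" where
  "ordered_basis B \<longleftrightarrow> list_independent B \<and> span (set B) = UNIV"

text \<open>Column \<open>j\<close> holds the coordinates of \<open>vs ! j\<close> in the basis \<open>B\<close>.\<close>

definition coord_mat :: "'a::euclidean_space list \<Rightarrow> 'a list \<Rightarrow> real mat" where
  "coord_mat B vs =
     mat (length B) (length vs) (\<lambda>(i, j). representation (set B) (vs ! j) (B ! i))"

definition same_orientation :: "('a::euclidean_space list \<times> 'a list) set" where
  "same_orientation =
     {(B, C). ordered_basis B \<and> ordered_basis C \<and> Determinant.det (coord_mat B C) > 0}"

definition orientations :: "'a::euclidean_space list set set" where
  "orientations = Collect ordered_basis // same_orientation"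

definition positive_orthonormal_basis :: "'a::euclidean_space list set \<Rightarrow> 'a list \<Rightarrow> bool" where
  "positive_orthonormal_basis \<O> B \<longleftrightarrow> B \<in> \<O> \<and>
     (\<forall>i<length B. \<forall>j<length B. inner (B ! i) (B ! j) = (if i = j then 1 else 0))"

text \<open>
  The common value, over all positive orthonormal bases, of the determinant of the coordinate
  matrix; meant for lists of length \<open>DIM('a)\<close>.
\<close>

definition oriented_det :: "'a::euclidean_space list set \<Rightarrow> 'a list \<Rightarrow> real" where
  "oriented_det \<O> vs =
     (THE d. \<forall>B. positive_orthonormal_basis \<O> B \<longrightarrow> Determinant.det (coord_mat B vs) = d)"

definition vol :: "'a::real_inner list \<Rightarrow> real" where
  "vol vs = sqrt (Determinant.det
     (mat (length vs) (length vs) (\<lambda>(i, j). inner (vs ! i) (vs ! j))))"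

text \<open>Iterated derivative of a curve on \<open>{a..b}\<close>, one-sided at the end points.\<close>

fun nth_derivative :: "real \<Rightarrow> real \<Rightarrow> (real \<Rightarrow> 'a::real_normed_vector) \<Rightarrow> nat \<Rightarrow> real \<Rightarrow> 'a" where
  "nth_derivative a b c 0 t = c t"
| "nth_derivative a b c (Suc k) t =
     vector_derivative (nth_derivative a b c k) (at t within {a..b})"

text \<open>The list of \<open>c'(t), \<dots>, c\<^sup>(\<^sup>k\<^sup>)(t)\<close>, empty for \<open>k = 0\<close>.\<close>

definition derivs :: "real \<Rightarrow> real \<Rightarrow> (real \<Rightarrow> 'a::real_normed_vector) \<Rightarrow> nat \<Rightarrow> real \<Rightarrow> 'a list" where
  "derivs a b c k t = map (\<lambda>i. nth_derivative a b c i t) [1..<Suc k]"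

text \<open>
  ``Differentiable as many times as needed'' is read as \<open>n\<close> times differentiable, \<open>n = DIM('a)\<close>:
  this is what makes \<open>c\<^sup>(\<^sup>n\<^sup>)\<close> and the derivatives of the Frenet-Serret frame exist.
\<close>

definition regular_curve :: "real \<Rightarrow> real \<Rightarrow> (real \<Rightarrow> 'a::euclidean_space) \<Rightarrow> bool" where
  "regular_curve a b c \<longleftrightarrow> a < b \<and>
     (\<forall>k<DIM('a). \<forall>t\<in>{a..b}. nth_derivative a b c k differentiable (at t within {a..b})) \<and>
     (\<forall>t\<in>{a..b}. list_independent (derivs a b c (DIM('a) - 1) t))"

text \<open>Gram-Schmidt orthonormalization of the sequence \<open>v 1, v 2, \<dots>\<close> (numbered from 1).\<close>

fun gram_schmidt_vec :: "(nat \<Rightarrow> 'a::real_inner) \<Rightarrow> nat \<Rightarrow> 'a" where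
  "gram_schmidt_vec v i =
     (let w = v i - (\<Sum>j\<in>{1..<i}. inner (v i) (gram_schmidt_vec v j) *\<^sub>R gram_schmidt_vec v j)
      in w /\<^sub>R norm w)"

declare gram_schmidt_vec.simps [simp del]

text \<open>The vectors \<open>e\<^sub>1, \<dots>, e\<^sub>n\<close> of the frame; the values at other indices are irrelevant.\<close>

definition frenet_frame ::
    "'a::euclidean_space list set \<Rightarrow> real \<Rightarrow> real \<Rightarrow> (real \<Rightarrow> 'a) \<Rightarrow> nat \<Rightarrow> real \<Rightarrow> 'a" where
  "frenet_frame \<O> a b c i t =
     (let e = gram_schmidt_vec (\<lambda>k. nth_derivative a b c k t)
      in if i = DIM('a)
         then (THE x. positive_orthonormal_basis \<O> (map e [1..<DIM('a)] @ [x]))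
         else e i)"

text \<open>
  The curvatures at \<open>t\<close> are the coefficients in the Frenet-Serret equation.  Setting \<open>\<kappa> i = 0\<close> for
  \<open>i \<notin> {1..<n}\<close> removes the terms with \<open>e\<^sub>0\<close> and \<open>e\<^sub>n\<^sub>+\<^sub>1\<close> and makes the function \<open>\<kappa>\<close> unique.
\<close>

definition frenet_serret_at ::
    "'a::euclidean_space list set \<Rightarrow> real \<Rightarrow> real \<Rightarrow> (real \<Rightarrow> 'a) \<Rightarrow> real \<Rightarrow> (nat \<Rightarrow> real) \<Rightarrow> bool" where
  "frenet_serret_at \<O> a b c t \<kappa> \<longleftrightarrow>
     (let e = frenet_frame \<O> a b c
      in (\<forall>i. i \<notin> {1..<DIM('a)} \<longrightarrow> \<kappa> i = 0) \<and>
         (\<forall>i\<in>{1..DIM('a)}.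
            (e i has_vector_derivative
               norm (nth_derivative a b c 1 t) *\<^sub>R
                 (- \<kappa> (i - 1) *\<^sub>R e (i - 1) t + \<kappa> i *\<^sub>R e (i + 1) t))
            (at t within {a..b})))"

definition curvature ::
    "'a::euclidean_space list set \<Rightarrow> real \<Rightarrow> real \<Rightarrow> (real \<Rightarrow> 'a) \<Rightarrow> nat \<Rightarrow> real \<Rightarrow> real" where
  "curvature \<O> a b c r t = (THE \<kappa>. frenet_serret_at \<O> a b c t \<kappa>) r"

end

theory Submission
  imports Defs
begin

text \<open>
  Write \<open>v\<^sub>k = c\<^sup>(\<^sup>k\<^sup>)\<close> and \<open>R\<^sub>k = \<langle>v\<^sub>k, e\<^sub>k\<rangle>\<close>. Since \<open>v\<^sub>1, \<dots>, v\<^sub>k\<close> is triangular with respect to the frame,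
  \<open>vol (v\<^sub>1, \<dots>, v\<^sub>k) = R\<^sub>1 \<cdots> R\<^sub>k\<close> for \<open>k < n\<close> and \<open>det (v\<^sub>1, \<dots>, v\<^sub>n) = R\<^sub>1 \<cdots> R\<^sub>n\<close>, so both identities
  say \<open>\<kappa>\<^sub>r \<parallel>c'\<parallel> = R\<^sub>r\<^sub>+\<^sub>1 / R\<^sub>r\<close>. Differentiating \<open>\<langle>v\<^sub>r, e\<^sub>k\<rangle> = 0\<close> for \<open>r < k\<close> gives
  \<open>\<langle>v\<^sub>r, e\<^sub>k'\<rangle> = - \<langle>v\<^sub>r\<^sub>+\<^sub>1, e\<^sub>k\<rangle>\<close>. For \<open>k > r + 1\<close> this vanishes, whence \<open>\<langle>e\<^sub>r, e\<^sub>k'\<rangle> = 0\<close>; for \<open>k = r + 1\<close>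
  it becomes \<open>R\<^sub>r \<langle>e\<^sub>r, e\<^sub>r\<^sub>+\<^sub>1'\<rangle> = - R\<^sub>r\<^sub>+\<^sub>1\<close>. The last vector \<open>e\<^sub>n\<close> is differentiable because it
  represents the functional \<open>w \<mapsto> det (e\<^sub>1, \<dots>, e\<^sub>n\<^sub>-\<^sub>1, w)\<close>.
\<close>

subsection \<open>Determinants of inner products\<close>

text \<open>For \<open>u = w\<close> this is the Gram determinant behind \<open>vol\<close>; for an
  orthonormal basis \<open>u\<close> it is the determinant of the coordinates of \<open>w\<close>.
  One notion thus serves both volumes and oriented determinants.\<close>

definition gram_det :: "nat \<Rightarrow> (nat \<Rightarrow> 'a::real_inner) \<Rightarrow> (nat \<Rightarrow> 'a) \<Rightarrow> real" where
  "gram_det m u w = Determinant.det (mat m m (\<lambda>(i, j). inner (u i) (w j)))"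

definition orthonormal :: "nat \<Rightarrow> (nat \<Rightarrow> 'a::real_inner) \<Rightarrow> bool" where
  "orthonormal m e \<longleftrightarrow> (\<forall>i<m. \<forall>j<m. inner (e i) (e j) = (if i = j then 1 else 0))"

lemma gram_det_cong:
  assumes "\<And>i. i < m \<Longrightarrow> u i = u' i" "\<And>i. i < m \<Longrightarrow> w i = w' i"
  shows "gram_det m u w = gram_det m u' w'"
  unfolding gram_det_def by (intro arg_cong[of _ _ Determinant.det] cong_mat) (simp_all add: assms)

lemma gram_det_commute: "gram_det m u w = gram_det m w u"
proof -
  have "mat m m (\<lambda>(i, j). inner (w i) (u j)) = transpose_mat (mat m m (\<lambda>(i, j). inner (u i) (w j)))"
    by (intro eq_matI) (auto simp: inner_commute)
  then show ?thesis
    unfolding gram_det_def using det_transpose[of "mat m m (\<lambda>(i, j). inner (u i) (w j))" m]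
    by simp
qed

text \<open>Inserting the expansion of each \<open>u i\<close> turns the matrix of inner products
  into a matrix product. Since only the \<open>u i\<close> must have such an expansion,
  \<open>m\<close> may be smaller than the dimension.\<close>

lemma gram_det_mult:
  assumes "\<And>i. i < m \<Longrightarrow> u i = (\<Sum>k<m. inner (u i) (e k) *\<^sub>R e k)"
  shows "gram_det m u w = gram_det m u e * gram_det m e w"
proof -
  let ?A = "mat m m (\<lambda>(i, j). inner (u i) (e j))"
  let ?B = "mat m m (\<lambda>(i, j). inner (e i) (w j))"
  have "mat m m (\<lambda>(i, j). inner (u i) (w j)) = ?A * ?B"
  proof (intro eq_matI)
    fix i j assume "i < dim_row (?A * ?B)" "j < dim_col (?A * ?B)"
    then have ij: "i < m" "j < m" by auto
    have "inner (u i) (w j) = inner (\<Sum>k<m. inner (u i) (e k) *\<^sub>R e k) (w j)"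
      using assms[OF ij(1)] by simp
    also have "\<dots> = (\<Sum>k<m. inner (u i) (e k) * inner (e k) (w j))"
      by (simp add: inner_sum_left)
    finally show "mat m m (\<lambda>(i, j). inner (u i) (w j)) $$ (i, j) = (?A * ?B) $$ (i, j)"
      using ij by (simp add: scalar_prod_def atLeast0LessThan)
  qed auto
  then show ?thesis
    unfolding gram_det_def by (simp add: det_mult[of _ m])
qed

lemma gram_det_triangular:
  assumes "\<And>i j. \<lbrakk>j < i; i < m\<rbrakk> \<Longrightarrow> inner (u i) (w j) = 0"
  shows "gram_det m u w = (\<Prod>i<m. inner (u i) (w i))"
proof -
  let ?A = "mat m m (\<lambda>(i, j). inner (u i) (w j))"
  have "Determinant.det ?A = prod_list (diag_mat ?A)"
    by (rule det_upper_triangular[of _ m]) (auto simp: upper_triangular_def assms)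
  then show ?thesis
    unfolding gram_det_def by (simp add: prod_list_diag_prod atLeast0LessThan)
qed

lemma gram_det_orthonormal: "orthonormal m e \<Longrightarrow> gram_det m e e = 1"
  by (subst gram_det_triangular) (auto simp: orthonormal_def)

text \<open>The Leibniz formula is a polynomial in the inner products, each of which is
  differentiable.\<close>

lemma differentiable_gram_det:
  assumes "\<And>i. i < m \<Longrightarrow> (\<lambda>s. w s i) differentiable (at t within S)"
  shows "(\<lambda>s. gram_det m u (w s)) differentiable (at t within S)"
proof -
  have less: "p i < m" if "p permutes {0..<m}" "i < m" for p i
    using permutes_in_image[OF that(1)] that(2) by simp
  have "(\<lambda>s. gram_det m u (w s)) = (\<lambda>s. \<Sum>p | p permutes {0..<m}. signof p *
      (\<Prod>i<m. inner (u i) (w s (p i))))"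
    unfolding gram_det_def Determinant.det_def
    by (auto simp: fun_eq_iff atLeast0LessThan less intro!: sum.cong prod.cong)
  moreover have "(\<lambda>s. \<Prod>i<m. inner (u i) (w s (p i))) differentiable (at t within S)"
    if "p permutes {0..<m}" for p
  proof -
    have "(\<lambda>s. inner (u i) (w s (p i))) differentiable (at t within S)" if "i < m" for i
      using assms[of "p i"] that \<open>p permutes {0..<m}\<close>
      by (auto simp: less intro!: differentiable_inner)
    then obtain f' where "\<And>i. i < m \<Longrightarrow>
        ((\<lambda>s. inner (u i) (w s (p i))) has_derivative f' i) (at t within S)"
      unfolding differentiable_def by metis
    then show ?thesis
      by (intro differentiableI[OF has_derivative_prod[of "{..<m}"]]) auto
  qed
  ultimately show ?thesis
    by (simp add: finite_permutations differentiable_sum differentiable_mult)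
qed

lemma vol_gram_det: "vol vs = sqrt (gram_det (length vs) (nth vs) (nth vs))"
  unfolding vol_def gram_det_def ..

subsection \<open>Orthonormal families\<close>

lemma orthonormal_inj: "orthonormal m e \<Longrightarrow> inj_on e {..<m}"
  unfolding orthonormal_def inj_on_def by (metis lessThan_iff zero_neq_one)

lemma orthonormal_independent:
  assumes "orthonormal m e"
  shows "independent (e ` {..<m})"
proof (rule pairwise_orthogonal_independent)
  show "pairwise Linear_Algebra.orthogonal (e ` {..<m})"
    using assms by (auto simp: pairwise_def Linear_Algebra.orthogonal_def orthonormal_def)
  show "0 \<notin> e ` {..<m}"
  proof
    assume "0 \<in> e ` {..<m}"
    then obtain i where "i < m" "e i = 0" by auto
    then show False using assms unfolding orthonormal_def by (metis inner_zero_left zero_neq_one)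
  qed
qed

lemma orthonormal_span:
  fixes e :: "nat \<Rightarrow> 'a::euclidean_space"
  assumes "orthonormal DIM('a) e"
  shows "span (e ` {..<DIM('a)}) = UNIV"
proof -
  have "card (e ` {..<DIM('a)}) = DIM('a)"
    using orthonormal_inj[OF assms] by (simp add: card_image)
  then show ?thesis
    using orthonormal_independent[OF assms]
    by (metis dim_eq_full dim_eq_card_independent)
qed

text \<open>Both sides are linear in \<open>x\<close>, so it suffices to compare them at the vectors
  \<open>e i\<close>.\<close>

lemma orthonormal_expand:
  assumes "orthonormal m e" "x \<in> span (e ` {..<m})"
  shows "x = (\<Sum>k<m. inner x (e k) *\<^sub>R e k)"
  using assms(2)
proof (induction rule: span_induct_alt)
  case (step a y z)
  then obtain i where i: "i < m" "y = e i" by auto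
  have "(\<Sum>k<m. inner (e i) (e k) *\<^sub>R e k) = e i"
    using assms(1) i unfolding orthonormal_def
    by (subst sum.mono_neutral_right[of _ "{i}"]) auto
  moreover have "(\<Sum>k<m. inner (a *\<^sub>R y + z) (e k) *\<^sub>R e k)
      = a *\<^sub>R (\<Sum>k<m. inner (e i) (e k) *\<^sub>R e k) + (\<Sum>k<m. inner z (e k) *\<^sub>R e k)"
    by (simp add: i inner_add_left scaleR_add_left sum.distrib scaleR_sum_right)
  ultimately show ?case using step i by simp
qed simp

lemma orthonormal_expand_UNIV:
  fixes e :: "nat \<Rightarrow> 'a::euclidean_space"
  assumes "orthonormal DIM('a) e"
  shows "x = (\<Sum>k<DIM('a). inner x (e k) *\<^sub>R e k)"
  using orthonormal_expand[OF assms] orthonormal_span[OF assms] by blast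

lemma ordered_basis_length: "ordered_basis (B :: 'a::euclidean_space list) \<Longrightarrow> length B = DIM('a)"
  unfolding ordered_basis_def list_independent_def
  by (metis dim_UNIV dim_eq_card_independent dim_span distinct_card)

lemma ordered_basis_orthonormal:
  assumes "length B = DIM('a::euclidean_space)" "orthonormal DIM('a) (nth (B :: 'a list))"
  shows "ordered_basis B"
proof -
  have "set B = nth B ` {..<DIM('a)}"
    using assms(1) by (auto simp: set_conv_nth)
  moreover have "distinct B"
    using orthonormal_inj[OF assms(2)] assms(1) by (auto simp: distinct_conv_nth inj_on_def)
  ultimately show ?thesis
    unfolding ordered_basis_def list_independent_def
    using orthonormal_independent[OF assms(2)] orthonormal_span[OF assms(2)] by simp
qed

lemma orthonormal_cong:
  "(\<And>i. i < m \<Longrightarrow> e i = f i) \<Longrightarrow> orthonormal m e \<longleftrightarrow> orthonormal m f"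
  unfolding orthonormal_def by simp

lemma orthonormal_eqI:
  fixes e :: "nat \<Rightarrow> 'a::euclidean_space"
  assumes "orthonormal DIM('a) e" "\<And>k. k < DIM('a) \<Longrightarrow> inner x (e k) = inner y (e k)"
  shows "x = y"
  using orthonormal_expand_UNIV[OF assms(1), of x] orthonormal_expand_UNIV[OF assms(1), of y] assms(2)
  by simp

lemma inner_span_zero:
  assumes "x \<in> span S" "\<And>x. x \<in> S \<Longrightarrow> inner x y = 0"
  shows "inner x y = 0"
  using assms(1) by (induction rule: span_induct_alt) (auto simp: inner_add_left assms(2))

subsection \<open>Determinants and orientations\<close>

definition basis_list :: "'a::euclidean_space list" where
  "basis_list = (SOME xs. set xs = Basis \<and> distinct xs)"

lemma basis_list: "set (basis_list :: 'a::euclidean_space list) = Basis"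
    "distinct (basis_list :: 'a list)"
  using someI_ex[OF finite_distinct_list[OF finite_Basis]] unfolding basis_list_def by auto

lemma length_basis_list: "length (basis_list :: 'a::euclidean_space list) = DIM('a)"
  by (metis basis_list distinct_card)

lemma orthonormal_basis_list: "orthonormal DIM('a) (nth (basis_list :: 'a::euclidean_space list))"
  unfolding orthonormal_def
  using basis_list length_basis_list[where 'a='a]
  by (metis inner_Basis nth_eq_iff_index_eq nth_mem)

text \<open>A reference determinant that ignores the orientation. The order of
  \<open>basis_list\<close> is arbitrary, so its sign has no meaning by itself.\<close>

definition std_det :: "(nat \<Rightarrow> 'a::euclidean_space) \<Rightarrow> real" where
  "std_det = gram_det DIM('a) (nth basis_list)"

lemma std_det_cong:
  fixes e :: "nat \<Rightarrow> 'a::euclidean_space"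
  shows "(\<And>i. i < DIM('a) \<Longrightarrow> e i = f i) \<Longrightarrow> std_det e = std_det f"
  unfolding std_det_def by (rule gram_det_cong) auto

lemma std_det_orthonormal_mult:
  fixes e :: "nat \<Rightarrow> 'a::euclidean_space"
  assumes "orthonormal DIM('a) e"
  shows "std_det vs = std_det e * gram_det DIM('a) e vs"
  unfolding std_det_def by (rule gram_det_mult) (rule orthonormal_expand_UNIV[OF assms])

text \<open>The Gram determinant of \<open>e\<close>, which is 1, factors through
  \<open>basis_list\<close> into the determinants of two transposed matrices.\<close>

lemma std_det_orthonormal_square:
  fixes e :: "nat \<Rightarrow> 'a::euclidean_space"
  assumes "orthonormal DIM('a) e"
  shows "std_det e * std_det e = 1"
proof -
  have "gram_det DIM('a) e e = gram_det DIM('a) e (nth basis_list) * std_det e"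
    unfolding std_det_def
    by (rule gram_det_mult) (rule orthonormal_expand_UNIV[OF orthonormal_basis_list])
  then show ?thesis
    using gram_det_orthonormal[OF assms] by (simp add: std_det_def gram_det_commute)
qed

text \<open>Change of basis: expanding the vectors of \<open>vs\<close> in \<open>B\<close> factors
  their matrix against \<open>basis_list\<close>. As \<open>B\<close> is any ordered basis, this
  links the orientation classes to signs of \<open>std_det\<close>.\<close>

lemma std_det_coord_mat:
  fixes B vs :: "'a::euclidean_space list"
  assumes "ordered_basis B" "length vs = DIM('a)"
  shows "std_det (nth vs) = std_det (nth B) * Determinant.det (coord_mat B vs)"
proof -
  let ?n = "DIM('a)" and ?E = "basis_list :: 'a list"
  have len: "length B = ?n" using ordered_basis_length assms(1) .
  let ?A = "mat ?n ?n (\<lambda>(i, j). inner (?E ! i) (B ! j))"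
  have B: "distinct B" "independent (set B)" "span (set B) = UNIV"
    using assms(1) by (auto simp: ordered_basis_def list_independent_def)
  have cm: "coord_mat B vs \<in> carrier_mat ?n ?n"
    unfolding coord_mat_def using len assms(2) by simp
  have expand: "x = (\<Sum>k<?n. representation (set B) x (B ! k) *\<^sub>R B ! k)" for x
  proof -
    have "x = (\<Sum>b\<in>set B. representation (set B) x b *\<^sub>R b)"
      using B by (intro sum_representation_eq[symmetric]) auto
    also have "\<dots> = (\<Sum>k<?n. representation (set B) x (B ! k) *\<^sub>R B ! k)"
      using bij_betw_nth[OF B(1) refl refl] len
      by (intro sum.reindex_bij_betw[symmetric]) simp
    finally show ?thesis .
  qed
  have "mat ?n ?n (\<lambda>(i, j). inner (?E ! i) (vs ! j)) = ?A * coord_mat B vs"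
  proof (intro eq_matI)
    fix i j assume "i < dim_row (?A * coord_mat B vs)" "j < dim_col (?A * coord_mat B vs)"
    then have ij: "i < ?n" "j < ?n" using cm by auto
    have "inner (?E ! i) (vs ! j)
        = inner (?E ! i) (\<Sum>k<?n. representation (set B) (vs ! j) (B ! k) *\<^sub>R B ! k)"
      using expand[of "vs ! j"] by simp
    also have "\<dots> = (\<Sum>k<?n. inner (?E ! i) (B ! k) * representation (set B) (vs ! j) (B ! k))"
      by (simp add: inner_sum_right mult.commute)
    finally show "mat ?n ?n (\<lambda>(i, j). inner (?E ! i) (vs ! j)) $$ (i, j)
        = (?A * coord_mat B vs) $$ (i, j)"
      using ij cm len assms(2) by (simp add: scalar_prod_def atLeast0LessThan coord_mat_def)
  qed (use cm in auto)
  then show ?thesis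
    unfolding std_det_def gram_det_def using cm by (simp add: det_mult[of _ ?n])
qed

text \<open>For a representative \<open>B\<close> of the class, the sign of
  \<open>std_det (nth B)\<close> serves as \<open>\<sigma>\<close>: the change-of-basis determinant
  is positive exactly when the two values of \<open>std_det\<close> have the same sign.\<close>

lemma orientation_sign:
  fixes \<O> :: "'a::euclidean_space list set"
  assumes "\<O> \<in> orientations"
  obtains \<sigma> where "\<sigma> = 1 \<or> \<sigma> = -1"
    "\<And>C. C \<in> \<O> \<longleftrightarrow> ordered_basis C \<and> \<sigma> * std_det (nth C) > 0"
proof -
  obtain B where B: "ordered_basis B" and \<O>: "\<O> = same_orientation `` {B}"
    using assms unfolding orientations_def quotient_def by auto
  have "ordered_basis (basis_list :: 'a list)"
    by (rule ordered_basis_orthonormal[OF length_basis_list orthonormal_basis_list])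
  then have "std_det (nth (basis_list :: 'a list)) = std_det (nth B) * Determinant.det (coord_mat B basis_list)"
    using std_det_coord_mat[OF B length_basis_list] by simp
  \<comment> \<open>Otherwise \<open>std_det\<close> of \<open>basis_list\<close>, a multiple of
    this number, would vanish, while its square is 1.\<close>
  then have nz: "std_det (nth B) \<noteq> 0"
    using std_det_orthonormal_square[OF orthonormal_basis_list[where 'a='a]] by auto
  have "C \<in> \<O> \<longleftrightarrow> ordered_basis C \<and> sgn (std_det (nth B)) * std_det (nth C) > 0" for C
  proof (cases "ordered_basis C")
    case True
    then have "sgn (std_det (nth B)) * std_det (nth C)
        = \<bar>std_det (nth B)\<bar> * Determinant.det (coord_mat B C)"
      using std_det_coord_mat[OF B ordered_basis_length[OF True]] by (simp add: abs_sgn ac_simps)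
    then show ?thesis using True B nz unfolding \<O> same_orientation_def
      by (auto simp: zero_less_mult_iff)
  qed (auto simp: \<O> same_orientation_def)
  moreover have "sgn (std_det (nth B)) = 1 \<or> sgn (std_det (nth B)) = -1"
    using nz by (auto simp: sgn_if)
  ultimately show ?thesis using that by blast
qed

text \<open>Against \<open>e\<close> the modified family has the identity matrix except in the last
  column, so the determinant is the last diagonal entry. Hence the last basis vector represents a
  linear functional of \<open>w\<close>.\<close>

lemma std_det_replace_last:
  fixes e :: "nat \<Rightarrow> 'a::euclidean_space"
  assumes "orthonormal DIM('a) e"
  shows "std_det (e(DIM('a) - 1 := w)) = std_det e * inner w (e (DIM('a) - 1))"
proof -
  let ?n = "DIM('a)"
  have "gram_det ?n e (e(?n - 1 := w)) = (\<Prod>i<?n. inner (e i) ((e(?n - 1 := w)) i))"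
    using assms by (intro gram_det_triangular) (auto simp: orthonormal_def)
  also have "\<dots> = (\<Prod>i<?n. if i = ?n - 1 then inner (e i) w else 1)"
    using assms by (intro prod.cong) (auto simp: orthonormal_def)
  also have "\<dots> = inner w (e (?n - 1))"
    using DIM_positive[where 'a='a] by (simp add: inner_commute del: DIM_positive)
  finally show ?thesis using std_det_orthonormal_mult[OF assms, of "e(?n - 1 := w)"] by simp
qed

text \<open>One vector fewer than the dimension cannot span the space, so some nonzero vector is
  orthogonal to all of them; it is then normalized.\<close>

lemma orthonormal_extend:
  fixes e :: "nat \<Rightarrow> 'a::euclidean_space"
  assumes "orthonormal (DIM('a) - 1) e"
  obtains x where "orthonormal DIM('a) (e(DIM('a) - 1 := x))"
proof -
  let ?n = "DIM('a)"
  have "dim (span (e ` {..<?n - 1})) \<le> card (e ` {..<?n - 1})"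
    by (simp add: dim_le_card')
  also have "\<dots> \<le> ?n - 1" using card_image_le[of "{..<?n - 1}" e] by simp
  also have "\<dots> < ?n" using DIM_positive[where 'a='a] by simp
  finally have "span (e ` {..<?n - 1}) \<noteq> UNIV"
    by (metis dim_UNIV less_irrefl)
  then obtain y where y: "y \<noteq> 0" "\<And>x. x \<in> span (e ` {..<?n - 1}) \<Longrightarrow> inner y x = 0"
    using span_not_UNIV_orthogonal[of "e ` {..<?n - 1}"] by (metis span_span)
  have "inner y (e i) = 0" if "i < ?n - 1" for i
    using that by (intro y(2) span_base) auto
  moreover have "inner (y /\<^sub>R norm y) (y /\<^sub>R norm y) = 1"
    using y(1) by (simp add: dot_square_norm power2_eq_square)
  ultimately have "orthonormal ?n (e(?n - 1 := y /\<^sub>R norm y))"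
    using assms unfolding orthonormal_def
    by (auto simp: inner_commute[of _ y] simp del: inner_scaleR_left inner_scaleR_right)
       (auto simp: inner_commute)
  then show ?thesis using that by blast
qed

text \<open>Reversing the added vector reverses the sign of the determinant, which is 1 or -1, so
  one of the two choices fits \<open>\<sigma>\<close>.\<close>

lemma orthonormal_extend_positive:
  fixes e :: "nat \<Rightarrow> 'a::euclidean_space"
  assumes "orthonormal (DIM('a) - 1) e" "\<sigma> = 1 \<or> \<sigma> = -1"
  obtains x where "orthonormal DIM('a) (e(DIM('a) - 1 := x))" "\<sigma> * std_det (e(DIM('a) - 1 := x)) = 1"
proof -
  let ?n = "DIM('a)"
  obtain x where x: "orthonormal ?n (e(?n - 1 := x))"
    using orthonormal_extend[OF assms(1)] .
  have "?n - 1 < ?n" by simp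
  then have "inner ((e(?n - 1 := x)) (?n - 1)) ((e(?n - 1 := x)) (?n - 1))
      = (if ?n - 1 = ?n - 1 then 1 else 0)"
    using x unfolding orthonormal_def by blast
  then have "inner x x = 1" by simp
  then have "std_det (e(?n - 1 := - x)) = - std_det (e(?n - 1 := x))"
    using std_det_replace_last[OF x, of "- x"] by simp
  moreover have "orthonormal ?n (e(?n - 1 := - x))"
    unfolding orthonormal_def
  proof (intro allI impI)
    fix i j assume "i < ?n" "j < ?n"
    then have "inner ((e(?n - 1 := x)) i) ((e(?n - 1 := x)) j) = (if i = j then 1 else 0)"
      using x unfolding orthonormal_def by blast
    then show "inner ((e(?n - 1 := - x)) i) ((e(?n - 1 := - x)) j) = (if i = j then 1 else 0)"
      by (cases "i = ?n - 1"; cases "j = ?n - 1") auto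
  qed
  moreover have "std_det (e(?n - 1 := x)) = 1 \<or> std_det (e(?n - 1 := x)) = -1"
    using std_det_orthonormal_square[OF x] by (simp add: square_eq_1_iff)
  ultimately show ?thesis using x that assms(2) by fastforce
qed

text \<open>The sign \<open>\<sigma>\<close> tells whether the arbitrary enumeration \<open>basis_list\<close> is positively oriented.\<close>

locale signed_orientation =
  fixes \<O> :: "'a::euclidean_space list set" and \<sigma> :: real
  assumes sign: "\<sigma> = 1 \<or> \<sigma> = -1"
    and mem_iff: "\<And>C. C \<in> \<O> \<longleftrightarrow> ordered_basis C \<and> \<sigma> * std_det (nth C) > 0"
begin

text \<open>The determinant of an orthonormal basis is 1 or -1, so the positivity in
  \<open>mem_iff\<close> sharpens to an equation.\<close>

lemma positive_orthonormal_basis_iff: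
  "positive_orthonormal_basis \<O> B \<longleftrightarrow>
     length B = DIM('a) \<and> orthonormal DIM('a) (nth B) \<and> \<sigma> * std_det (nth B) = 1"
proof
  assume B: "positive_orthonormal_basis \<O> B"
  then have len: "length B = DIM('a)"
    unfolding positive_orthonormal_basis_def mem_iff using ordered_basis_length by blast
  then have on: "orthonormal DIM('a) (nth B)"
    using B unfolding positive_orthonormal_basis_def orthonormal_def by simp
  have "std_det (nth B) = 1 \<or> std_det (nth B) = -1"
    using std_det_orthonormal_square[OF on] by (simp add: square_eq_1_iff)
  moreover have "\<sigma> * std_det (nth B) > 0"
    using B unfolding positive_orthonormal_basis_def mem_iff by blast
  ultimately show "length B = DIM('a) \<and> orthonormal DIM('a) (nth B) \<and> \<sigma> * std_det (nth B) = 1"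
    using len on sign by auto
next
  assume "length B = DIM('a) \<and> orthonormal DIM('a) (nth B) \<and> \<sigma> * std_det (nth B) = 1"
  then show "positive_orthonormal_basis \<O> B"
    using ordered_basis_orthonormal[of B]
    unfolding positive_orthonormal_basis_def mem_iff by (simp add: orthonormal_def)
qed

lemma oriented_det_eq:
  assumes e: "orthonormal DIM('a) e" "\<sigma> * std_det e = 1" and "length vs = DIM('a)"
  shows "oriented_det \<O> vs = gram_det DIM('a) e (nth vs)"
proof -
  have std: "gram_det DIM('a) e (nth vs) = \<sigma> * std_det (nth vs)"
    using e(2) by (simp add: std_det_orthonormal_mult[OF e(1), of "nth vs"] flip: mult.assoc)
  let ?B = "map e [0..<DIM('a)]"
  \<comment> \<open>This witness gives uniqueness in the definite description of
    \<open>oriented_det\<close>: with no positive orthonormal basis, every \<open>d\<close> would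
    satisfy it vacuously.\<close>
  have "positive_orthonormal_basis \<O> ?B"
    unfolding positive_orthonormal_basis_iff
    using e orthonormal_cong[of "DIM('a)" "nth ?B" e] std_det_cong[of "nth ?B" e] by simp
  moreover have "Determinant.det (coord_mat B vs) = \<sigma> * std_det (nth vs)"
    if B: "positive_orthonormal_basis \<O> B" for B
  proof -
    have "ordered_basis B" using B mem_iff unfolding positive_orthonormal_basis_def by blast
    then show ?thesis
      using B std_det_coord_mat[OF _ assms(3), of B] unfolding positive_orthonormal_basis_iff
      by (simp flip: mult.assoc)
  qed
  ultimately show ?thesis
    unfolding oriented_det_def std by (intro the_equality) blast+
qed

text \<open>Every admissible last vector represents the functional sending \<open>w\<close> to
  \<open>\<sigma> * std_det (g(DIM('a) - 1 := w))\<close>, hence there is only one. The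
  representation also expresses \<open>x\<close> without its definite description.\<close>

lemma positive_last_vector:
  fixes f :: "nat \<Rightarrow> 'a"
  defines "x \<equiv> THE x. positive_orthonormal_basis \<O> (map f [1..<DIM('a)] @ [x])"
    and "g \<equiv> (\<lambda>i. f (Suc i))"
  assumes "orthonormal (DIM('a) - 1) g"
  shows "orthonormal DIM('a) (g(DIM('a) - 1 := x))"
    and "\<sigma> * std_det (g(DIM('a) - 1 := x)) = 1"
    and "\<And>w. inner w x = \<sigma> * std_det (g(DIM('a) - 1 := w))"
proof -
  let ?n = "DIM('a)"
  have n: "length (map f [1..<?n] @ [y]) = ?n" for y by simp
  have nth: "(map f [1..<?n] @ [y]) ! i = (g(?n - 1 := y)) i" if "i < ?n" for y i
    using that by (auto simp: nth_append g_def)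
  have iff: "positive_orthonormal_basis \<O> (map f [1..<?n] @ [y]) \<longleftrightarrow>
      orthonormal ?n (g(?n - 1 := y)) \<and> \<sigma> * std_det (g(?n - 1 := y)) = 1" for y
    unfolding positive_orthonormal_basis_iff
    by (simp only: n orthonormal_cong[of ?n, OF nth[of _ y]] std_det_cong[OF nth[of _ y]] simp_thms)
  have repr: "inner w y = \<sigma> * std_det (g(?n - 1 := w))"
    if "orthonormal ?n (g(?n - 1 := y)) \<and> \<sigma> * std_det (g(?n - 1 := y)) = 1" for y w
  proof -
    have "std_det (g(?n - 1 := w)) = std_det (g(?n - 1 := y)) * inner w y"
      using std_det_replace_last[of "g(?n - 1 := y)" w] that by simp
    then have "\<sigma> * std_det (g(?n - 1 := w)) = (\<sigma> * std_det (g(?n - 1 := y))) * inner w y"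
      by (simp only: mult.assoc)
    also have "\<sigma> * std_det (g(?n - 1 := y)) = 1" using that by blast
    finally show ?thesis by (simp only: mult_1)
  qed
  obtain y where y: "orthonormal ?n (g(?n - 1 := y)) \<and> \<sigma> * std_det (g(?n - 1 := y)) = 1"
    by (rule orthonormal_extend_positive[OF assms(3) sign]) blast
  have "x = y"
    unfolding x_def iff
  proof (rule the_equality)
    show "z = y" if "orthonormal ?n (g(?n - 1 := z)) \<and> \<sigma> * std_det (g(?n - 1 := z)) = 1" for z
      by (rule iffD1[OF vector_eq_ldot], rule allI) (rule trans[OF repr[OF that] repr[OF y, symmetric]])
  qed (rule y)
  then show "orthonormal ?n (g(?n - 1 := x))" "\<sigma> * std_det (g(?n - 1 := x)) = 1"
    "\<And>w. inner w x = \<sigma> * std_det (g(?n - 1 := w))"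
    using y repr by auto
qed

end

subsection \<open>Gram-Schmidt orthonormalization\<close>

text \<open>Induction step of the orthonormalization: \<open>w\<close> is the part of
  \<open>v (Suc k)\<close> orthogonal to the earlier vectors, and it is nonzero because
  \<open>v (Suc k)\<close> lies outside their span.\<close>

lemma gram_schmidt_step:
  fixes v :: "nat \<Rightarrow> 'a::real_inner"
  assumes "\<And>i j. i \<in> {1..k} \<Longrightarrow> j \<in> {1..k} \<Longrightarrow>
      inner (gram_schmidt_vec v i) (gram_schmidt_vec v j) = (if i = j then 1 else 0)"
    and span: "span (gram_schmidt_vec v ` {1..k}) = span (v ` {1..k})"
    and notin: "v (Suc k) \<notin> span (v ` {1..k})"
  shows "inner (v (Suc k)) (gram_schmidt_vec v (Suc k)) > 0"
    and "inner (gram_schmidt_vec v (Suc k)) (gram_schmidt_vec v (Suc k)) = 1"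
    and "\<And>j. j \<in> {1..k} \<Longrightarrow> inner (gram_schmidt_vec v (Suc k)) (gram_schmidt_vec v j) = 0"
    and "span (gram_schmidt_vec v ` {1..Suc k}) = span (v ` {1..Suc k})"
proof -
  let ?e = "gram_schmidt_vec v"
  define p where "p = (\<Sum>j\<in>{1..k}. inner (v (Suc k)) (?e j) *\<^sub>R ?e j)"
  define w where "w = v (Suc k) - p"
  have e: "?e (Suc k) = w /\<^sub>R norm w"
    by (subst gram_schmidt_vec.simps) (simp add: Let_def w_def p_def atLeastLessThanSuc_atLeastAtMost)
  have p: "p \<in> span (?e ` {1..k})"
    unfolding p_def by (intro span_sum span_scale span_base) auto
  then have "w \<noteq> 0" using notin span unfolding w_def by auto
  have pe: "inner p (?e j) = inner (v (Suc k)) (?e j)" if "j \<in> {1..k}" for j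
  proof -
    have "inner p (?e j) = (\<Sum>i\<in>{1..k}. if i = j then inner (v (Suc k)) (?e i) else 0)"
      unfolding p_def inner_sum_left using assms(1) that by (intro sum.cong) auto
    then show ?thesis using that by simp
  qed
  then show orth: "inner (?e (Suc k)) (?e j) = 0" if "j \<in> {1..k}" for j
    using that by (simp add: e w_def inner_diff_left)
  \<comment> \<open>By orthogonality, pairing \<open>v (Suc k)\<close> with \<open>w\<close> gives
    the squared norm of \<open>w\<close>; this is the source of the positive diagonal
    coefficient.\<close>
  have "inner w p = 0"
    by (subst p_def) (simp add: inner_sum_right w_def inner_diff_left pe)
  then have "inner (v (Suc k)) w = inner w w"
    unfolding w_def by (simp add: inner_diff_left inner_diff_right inner_commute)
  then show "inner (v (Suc k)) (?e (Suc k)) > 0"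
    using \<open>w \<noteq> 0\<close> by (simp add: e)
  show "inner (?e (Suc k)) (?e (Suc k)) = 1"
    using \<open>w \<noteq> 0\<close> by (simp add: e dot_square_norm power2_eq_square)
  \<comment> \<open>Solving the recursion for \<open>v (Suc k)\<close> yields the reverse inclusion
    of the spans.\<close>
  have v: "v (Suc k) = norm w *\<^sub>R ?e (Suc k) + p"
    using \<open>w \<noteq> 0\<close> by (simp add: e w_def)
  have ins: "{1..Suc k} = insert (Suc k) {1..k}" by auto
  have mono: "span (f ` {1..k}) \<subseteq> span (f ` {1..Suc k})" for f :: "nat \<Rightarrow> 'a"
    by (intro span_mono image_mono) auto
  show "span (?e ` {1..Suc k}) = span (v ` {1..Suc k})"
  proof (rule span_eq[THEN iffD2], intro conjI subsetI)
    fix x assume "x \<in> ?e ` {1..Suc k}"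
    then consider "x = ?e (Suc k)" | "x \<in> ?e ` {1..k}" unfolding ins by auto
    then show "x \<in> span (v ` {1..Suc k})"
    proof cases
      case 1
      have "p \<in> span (v ` {1..Suc k})"
        using p unfolding span by (rule subsetD[OF mono])
      then show ?thesis unfolding 1 e w_def by (intro span_scale span_diff) (auto intro: span_base)
    next
      case 2
      then have "x \<in> span (v ` {1..k})" unfolding span[symmetric] by (rule span_base)
      then show ?thesis by (rule subsetD[OF mono])
    qed
  next
    fix x assume "x \<in> v ` {1..Suc k}"
    then consider "x = v (Suc k)" | "x \<in> v ` {1..k}" unfolding ins by auto
    then show "x \<in> span (?e ` {1..Suc k})"
    proof cases
      case 1
      have "p \<in> span (?e ` {1..Suc k})"
        using p by (rule subsetD[OF mono])
      then show ?thesis unfolding 1 v by (intro span_add span_scale) (auto intro: span_base)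
    next
      case 2
      then have "x \<in> span (?e ` {1..k})" unfolding span by (rule span_base)
      then show ?thesis by (rule subsetD[OF mono])
    qed
  qed
qed

lemma gram_schmidt_independent:
  assumes "inj_on v {1..m}" "independent (v ` {1..m})"
  shows "\<And>i j. i \<in> {1..m} \<Longrightarrow> j \<in> {1..m} \<Longrightarrow>
      inner (gram_schmidt_vec v i) (gram_schmidt_vec v j) = (if i = j then 1 else 0)"
    and "\<And>k. k \<le> m \<Longrightarrow> span (gram_schmidt_vec v ` {1..k}) = span (v ` {1..k})"
    and "\<And>i. i \<in> {1..m} \<Longrightarrow> inner (v i) (gram_schmidt_vec v i) > 0"
proof -
  let ?e = "gram_schmidt_vec v"
  \<comment> \<open>Injectivity keeps the earlier vectors in the set after \<open>v (Suc k)\<close>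
    is removed, so membership in their span would contradict independence.\<close>
  have notin: "v (Suc k) \<notin> span (v ` {1..k})" if "Suc k \<le> m" for k
  proof
    assume *: "v (Suc k) \<in> span (v ` {1..k})"
    have "v i \<in> v ` {1..m} - {v (Suc k)}" if "i \<in> {1..k}" for i
    proof -
      have i: "i \<noteq> Suc k" "i \<in> {1..m}" "Suc k \<in> {1..m}" using that \<open>Suc k \<le> m\<close> by auto
      then have "v i \<noteq> v (Suc k)" by (rule inj_on_contraD[OF assms(1)])
      then show ?thesis using i(2) by (intro DiffI imageI) simp_all
    qed
    then have "v ` {1..k} \<subseteq> v ` {1..m} - {v (Suc k)}" by (rule image_subsetI)
    then have "v (Suc k) \<in> span (v ` {1..m} - {v (Suc k)})"
      using * by (rule subsetD[OF span_mono])
    moreover have "v (Suc k) \<in> v ` {1..m}" using that by auto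
    ultimately show False using assms(2) unfolding dependent_def by blast
  qed
  have main: "(\<forall>i\<in>{1..k}. \<forall>j\<in>{1..k}. inner (?e i) (?e j) = (if i = j then 1 else 0)) \<and>
      span (?e ` {1..k}) = span (v ` {1..k})" if "k \<le> m" for k
    using that
  proof (induction k)
    case (Suc k)
    then have IH: "\<And>i j. i \<in> {1..k} \<Longrightarrow> j \<in> {1..k} \<Longrightarrow> inner (?e i) (?e j) = (if i = j then 1 else 0)"
      "span (?e ` {1..k}) = span (v ` {1..k})" by auto
    note step = gram_schmidt_step[OF IH notin[OF Suc.prems]]
    have ins: "{1..Suc k} = insert (Suc k) {1..k}" by auto
    have "inner (?e i) (?e j) = (if i = j then 1 else 0)" if "i \<in> {1..Suc k}" "j \<in> {1..Suc k}" for i j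
      using that IH(1) step(2) step(3)[of j] step(3)[of i] inner_commute[of "?e i" "?e j"]
      unfolding ins by auto
    then show ?case using step(4) by blast
  qed simp
  show "\<And>i j. i \<in> {1..m} \<Longrightarrow> j \<in> {1..m} \<Longrightarrow> inner (?e i) (?e j) = (if i = j then 1 else 0)"
    using main[of m] by auto
  show "\<And>k. k \<le> m \<Longrightarrow> span (?e ` {1..k}) = span (v ` {1..k})"
    using main by blast
  show "inner (v i) (?e i) > 0" if i: "i \<in> {1..m}" for i
  proof -
    obtain k where k: "i = Suc k" "Suc k \<le> m" using i by (cases i) auto
    have "\<And>i j. i \<in> {1..k} \<Longrightarrow> j \<in> {1..k} \<Longrightarrow> inner (?e i) (?e j) = (if i = j then 1 else 0)"
      "span (?e ` {1..k}) = span (v ` {1..k})" using main[of k] k by auto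
    from gram_schmidt_step(1)[OF this notin[OF k(2)]] show ?thesis unfolding k(1) .
  qed
qed

section \<open>Differentiability of the orthonormalized vectors\<close>

lemma differentiable_normalize:
  fixes f :: "real \<Rightarrow> 'a::real_inner"
  assumes "f differentiable (at t within S)" "f t \<noteq> 0"
  shows "(\<lambda>s. f s /\<^sub>R norm (f s)) differentiable (at t within S)"
proof -
  have "(\<lambda>s. norm (f s)) differentiable (at t within S)"
    using differentiable_chain_within[OF assms(1), of norm] assms(2)
      differentiable_at_withinI[OF differentiable_norm_at] by (auto simp: o_def)
  then show ?thesis
    using assms by (intro differentiable_scaleR differentiable_inverse) auto
qed

lemma differentiable_gram_schmidt:
  fixes v :: "real \<Rightarrow> nat \<Rightarrow> 'a::real_inner"
  assumes "\<And>i. i \<in> {1..m} \<Longrightarrow> (\<lambda>s. v s i) differentiable (at t within S)"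
    and "inj_on (v t) {1..m}" "independent (v t ` {1..m})"
    and "k \<in> {1..m}"
  shows "(\<lambda>s. gram_schmidt_vec (v s) k) differentiable (at t within S)"
  using assms(4)
proof (induction k rule: less_induct)
  case (less k)
  define w where "w s = v s k - (\<Sum>j\<in>{1..<k}. inner (v s k) (gram_schmidt_vec (v s) j) *\<^sub>R
      gram_schmidt_vec (v s) j)" for s
  have e: "gram_schmidt_vec (v s) k = w s /\<^sub>R norm (w s)" for s
    by (subst gram_schmidt_vec.simps) (simp add: Let_def w_def)
  \<comment> \<open>If \<open>w t\<close> were zero, so would be the Gram-Schmidt vector, against
    its positive inner product with \<open>v t k\<close>. Independence at the single point
    \<open>t\<close> is enough for this.\<close>
  have "w t \<noteq> 0"
    using gram_schmidt_independent(3)[OF assms(2,3) less.prems] by (auto simp: e)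
  moreover have "w differentiable (at t within S)"
    unfolding w_def using less assms(1)
    by (intro differentiable_diff differentiable_sum ballI differentiable_scaleR differentiable_inner)
      auto
  ultimately show ?case unfolding e by (rule differentiable_normalize[rotated])
qed

subsection \<open>The Frenet-Serret frame\<close>

text \<open>The product rule compared with the derivative of a constant. Since \<open>a < b\<close>,
  derivatives within the interval are unique even at its end points.\<close>

lemma vector_derivative_inner_const:
  fixes f g :: "real \<Rightarrow> 'a::real_inner"
  assumes "a < b" "t \<in> {a..b}"
    and f: "(f has_vector_derivative f') (at t within {a..b})"
    and g: "(g has_vector_derivative g') (at t within {a..b})"
    and const: "\<And>s. s \<in> {a..b} \<Longrightarrow> inner (f s) (g s) = C"
  shows "inner (f t) g' + inner f' (g t) = 0"
proof -
  have "((\<lambda>s. inner (f s) (g s)) has_vector_derivative inner (f t) g' + inner f' (g t))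
      (at t within {a..b})"
    using bounded_bilinear.has_vector_derivative[OF bounded_bilinear_inner f g] .
  moreover have "((\<lambda>s. inner (f s) (g s)) has_vector_derivative 0) (at t within {a..b})"
    using has_vector_derivative_transform[OF assms(2) const has_vector_derivative_const] .
  ultimately show ?thesis
    using vector_derivative_unique_within_closed_interval[of a b t] assms(1,2) by simp
qed

locale frenet_curve = signed_orientation \<O> \<sigma>
  for \<O> :: "'a::euclidean_space list set" and \<sigma> :: real +
  fixes a b :: real and c :: "real \<Rightarrow> 'a"
  assumes dim_ge_2: "DIM('a) \<ge> 2" and regular: "regular_curve a b c"
begin

abbreviation v :: "real \<Rightarrow> nat \<Rightarrow> 'a" where "v s k \<equiv> nth_derivative a b c k s"
abbreviation e :: "nat \<Rightarrow> real \<Rightarrow> 'a" where "e \<equiv> frenet_frame \<O> a b c"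

lemma interval: "a < b"
  using regular unfolding regular_curve_def by blast

lemma derivs_independent:
  assumes "s \<in> {a..b}"
  shows "inj_on (v s) {1..DIM('a) - 1}" "independent (v s ` {1..DIM('a) - 1})"
proof -
  have "set [1..<Suc (DIM('a) - 1)] = {1..DIM('a) - 1}"
    by (simp only: set_upt atLeastLessThanSuc_atLeastAtMost)
  moreover have "list_independent (map (v s) [1..<Suc (DIM('a) - 1)])"
    using regular assms unfolding regular_curve_def derivs_def by blast
  ultimately show "inj_on (v s) {1..DIM('a) - 1}" "independent (v s ` {1..DIM('a) - 1})"
    unfolding list_independent_def distinct_map set_map by metis+
qed

lemma has_vector_derivative_derivs:
  assumes "k < DIM('a)" "s \<in> {a..b}"
  shows "((\<lambda>s. v s k) has_vector_derivative v s (Suc k)) (at s within {a..b})"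
  using regular assms unfolding regular_curve_def by (simp add: vector_derivative_works)

lemma frame_gram_schmidt: "i < DIM('a) \<Longrightarrow> e i s = gram_schmidt_vec (v s) i"
  unfolding frenet_frame_def by (simp add: Let_def)

text \<open>Carries \<open>positive_last_vector\<close> over to the frame. The shift by
  \<open>Suc\<close> reconciles the frame, numbered from 1, with families numbered from 0.\<close>

lemma frame_orthonormal:
  assumes s: "s \<in> {a..b}"
  shows "orthonormal DIM('a) (\<lambda>i. e (Suc i) s)"
    and "\<sigma> * std_det (\<lambda>i. e (Suc i) s) = 1"
    and "\<And>w. inner w (e DIM('a) s) = \<sigma> * std_det ((\<lambda>i. e (Suc i) s)(DIM('a) - 1 := w))"
proof -
  let ?n = "DIM('a)" and ?f = "gram_schmidt_vec (v s)"
  let ?g = "\<lambda>i. ?f (Suc i)"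
  have "orthonormal (?n - 1) ?g"
    unfolding orthonormal_def
    using gram_schmidt_independent(1)[OF derivs_independent[OF s]] by auto
  note last = positive_last_vector[OF this]
  have en: "(THE x. positive_orthonormal_basis \<O> (map ?f [1..<?n] @ [x])) = e ?n s"
    unfolding frenet_frame_def by (simp add: Let_def)
  have upd: "(?g(?n - 1 := e ?n s)) i = e (Suc i) s" if "i < ?n" for i
    using that frame_gram_schmidt[of "Suc i" s] by auto
  have upd': "(?g(?n - 1 := w)) i = ((\<lambda>i. e (Suc i) s)(?n - 1 := w)) i" if "i < ?n" for i w
    using that frame_gram_schmidt[of "Suc i" s] by auto
  show "orthonormal ?n (\<lambda>i. e (Suc i) s)"
    by (rule iffD1[OF orthonormal_cong[OF upd] last(1)[unfolded en]])
  show "\<sigma> * std_det (\<lambda>i. e (Suc i) s) = 1"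
    using last(2)[unfolded en] by (simp only: std_det_cong[OF upd])
  show "inner w (e ?n s) = \<sigma> * std_det ((\<lambda>i. e (Suc i) s)(?n - 1 := w))" for w
    using last(3)[unfolded en, of w] by (simp only: std_det_cong[OF upd'[of _ w]])
qed

lemma frame_inner:
  assumes "s \<in> {a..b}" "i \<in> {1..DIM('a)}" "j \<in> {1..DIM('a)}"
  shows "inner (e i s) (e j s) = (if i = j then 1 else 0)"
proof -
  obtain i' j' where "i = Suc i'" "j = Suc j'" "i' < DIM('a)" "j' < DIM('a)"
    using assms(2,3) by (cases i; cases j) auto
  then show ?thesis using frame_orthonormal(1)[OF assms(1)] unfolding orthonormal_def by simp
qed

lemma frame_span:
  assumes "s \<in> {a..b}" "k < DIM('a)"
  shows "span ((\<lambda>i. e i s) ` {1..k}) = span (v s ` {1..k})"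
proof -
  have "(\<lambda>i. e i s) ` {1..k} = gram_schmidt_vec (v s) ` {1..k}"
    using assms(2) frame_gram_schmidt by (intro image_cong) auto
  then show ?thesis
    using gram_schmidt_independent(2)[OF derivs_independent[OF assms(1)], of k] assms(2) by simp
qed

text \<open>Triangularity: \<open>v s r\<close> lies in the span of the first \<open>r\<close> frame
  vectors, all orthogonal to \<open>e k s\<close>. The case \<open>k = DIM('a)\<close> is
  included.\<close>

lemma derivs_inner_frame:
  assumes "s \<in> {a..b}" "1 \<le> r" "r < k" "k \<le> DIM('a)"
  shows "inner (v s r) (e k s) = 0"
proof (rule inner_span_zero)
  show "v s r \<in> span ((\<lambda>i. e i s) ` {1..r})"
    using assms by (subst frame_span) (auto intro: span_base)
qed (use assms frame_inner in auto)

lemma derivs_inner_frame_pos: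
  assumes "s \<in> {a..b}" "1 \<le> r" "r < DIM('a)"
  shows "inner (v s r) (e r s) > 0"
  using gram_schmidt_independent(3)[OF derivs_independent[OF assms(1)], of r] assms
  by (simp add: frame_gram_schmidt)

lemma derivs_expand:
  assumes "s \<in> {a..b}" "1 \<le> r" "r < DIM('a)" "r \<le> m" "m \<le> DIM('a)"
  shows "v s r = (\<Sum>k<m. inner (v s r) (e (Suc k) s) *\<^sub>R e (Suc k) s)"
proof (rule orthonormal_expand)
  show "orthonormal m (\<lambda>k. e (Suc k) s)"
    using frame_orthonormal(1)[OF assms(1)] assms(5) unfolding orthonormal_def by simp
  have "v s r \<in> span ((\<lambda>i. e i s) ` {1..r})"
    using assms by (subst frame_span) (auto intro: span_base)
  moreover have "(\<lambda>i. e i s) ` {1..r} \<subseteq> (\<lambda>k. e (Suc k) s) ` {..<m}"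
  proof
    fix x assume "x \<in> (\<lambda>i. e i s) ` {1..r}"
    then obtain i where "i \<in> {1..r}" "x = e i s" by blast
    then show "x \<in> (\<lambda>k. e (Suc k) s) ` {..<m}"
      using assms(4) by (intro image_eqI[of _ _ "i - 1"]) auto
  qed
  ultimately show "v s r \<in> span ((\<lambda>k. e (Suc k) s) ` {..<m})"
    using span_mono by blast
qed

lemma frame_differentiable:
  assumes t: "t \<in> {a..b}" and "i \<in> {1..DIM('a)}"
  shows "e i differentiable (at t within {a..b})"
proof -
  let ?n = "DIM('a)"
  have gs: "e i differentiable (at t within {a..b})" if "i \<in> {1..?n - 1}" for i
  proof -
    have "e i = (\<lambda>s. gram_schmidt_vec (v s) i)"
      using that frame_gram_schmidt by auto
    moreover have "(\<lambda>s. v s k) differentiable (at t within {a..b})" if "k \<in> {1..?n - 1}" for k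
      using regular t that unfolding regular_curve_def by auto
    ultimately show ?thesis
      using differentiable_gram_schmidt[where v = v, OF _ derivs_independent[OF t] that, of "{a..b}"]
      by simp
  qed
  show ?thesis
  proof (cases "i = ?n")
    case True
    \<comment> \<open>The coordinates of the last frame vector in \<open>Basis\<close>, written
      through the functional it represents; they involve only the earlier frame vectors, covered by
      \<open>gs\<close>. Agreement with the frame is established on \<open>{a..b}\<close>, hence the
      transfer within that interval.\<close>
    define F where "F s = (\<Sum>w\<in>Basis. (\<sigma> * std_det ((\<lambda>i. e (Suc i) s)(?n - 1 := w))) *\<^sub>R w)" for s
    have "F s = e ?n s" if "s \<in> {a..b}" for s
      using frame_orthonormal(3)[OF that] euclidean_representation[of "e ?n s"]
      by (simp add: F_def inner_commute)
    moreover have "F differentiable (at t within {a..b})"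
      unfolding F_def std_det_def
    proof (intro differentiable_sum finite_Basis ballI differentiable_scaleR differentiable_mult
        differentiable_const differentiable_gram_det)
      fix w :: 'a and k assume k: "k < ?n"
      show "(\<lambda>s. ((\<lambda>i. e (Suc i) s)(?n - 1 := w)) k) differentiable (at t within {a..b})"
        using gs[of "Suc k"] k by (cases "k = ?n - 1") auto
    qed
    ultimately have "e ?n differentiable (at t within {a..b})"
      using t by (intro differentiable_transform_within[of F t "{a..b}" 1 "e ?n"]) auto
    then show ?thesis using True by simp
  qed (use gs assms(2) in auto)
qed

section \<open>Volumes and oriented determinant as products of diagonal coefficients\<close>

definition R :: "real \<Rightarrow> nat \<Rightarrow> real" where "R s r = inner (v s r) (e r s)"

text \<open>The bound \<open>r < DIM('a)\<close> matters: the last coefficient carries the sign of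
  the torsion and may be negative or zero.\<close>

lemma R_pos: "s \<in> {a..b} \<Longrightarrow> 1 \<le> r \<Longrightarrow> r < DIM('a) \<Longrightarrow> R s r > 0"
  unfolding R_def by (rule derivs_inner_frame_pos)

lemma gram_det_frame_derivs:
  assumes "s \<in> {a..b}" "k \<le> DIM('a)"
  shows "gram_det k (\<lambda>i. e (Suc i) s) (\<lambda>i. v s (Suc i)) = (\<Prod>i<k. R s (Suc i))"
proof -
  have "inner (e (Suc i) s) (v s (Suc j)) = 0" if "j < i" "i < k" for i j
    using derivs_inner_frame[OF assms(1), of "Suc j" "Suc i"] that assms(2)
    by (simp add: inner_commute)
  then show ?thesis
    by (subst gram_det_triangular) (simp_all add: R_def inner_commute)
qed

lemma derivs_nth: "i < k \<Longrightarrow> derivs a b c k s ! i = v s (Suc i)"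
  unfolding derivs_def by (simp del: upt_Suc)

lemma length_derivs: "length (derivs a b c k s) = k"
  unfolding derivs_def by simp

text \<open>Through the first \<open>k\<close> frame vectors the Gram determinant factors into two
  transposed triangular determinants, so it is a perfect square.\<close>

lemma vol_derivs:
  assumes s: "s \<in> {a..b}" and k: "k < DIM('a)"
  shows "vol (derivs a b c k s) = (\<Prod>i<k. R s (Suc i))"
proof -
  let ?V = "\<lambda>i. v s (Suc i)" and ?E = "\<lambda>i. e (Suc i) s"
  have "gram_det k ?V ?V = gram_det k ?V ?E * gram_det k ?E ?V"
    using s k by (intro gram_det_mult derivs_expand) auto
  also have "\<dots> = (\<Prod>i<k. R s (Suc i))\<^sup>2"
    using gram_det_frame_derivs[OF s, of k] k
    by (simp only: gram_det_commute[of k ?V] power2_eq_square less_imp_le)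
  finally have "vol (derivs a b c k s) = sqrt ((\<Prod>i<k. R s (Suc i))\<^sup>2)"
    unfolding vol_gram_det length_derivs by (simp only: gram_det_cong[OF derivs_nth derivs_nth])
  \<comment> \<open>The root returns the product itself because all its factors are positive, which
    relies on \<open>k < DIM('a)\<close>.\<close>
  moreover have "(\<Prod>i<k. R s (Suc i)) \<ge> 0"
    using R_pos[OF s] k by (intro prod_nonneg) (auto intro: less_imp_le)
  ultimately show ?thesis by simp
qed

text \<open>The frame itself serves as the positive orthonormal basis, in which the derivatives have
  a triangular matrix.\<close>

lemma oriented_det_derivs:
  assumes s: "s \<in> {a..b}"
  shows "oriented_det \<O> (derivs a b c DIM('a) s) = (\<Prod>i<DIM('a). R s (Suc i))"
  unfolding oriented_det_eq[OF frame_orthonormal(1,2)[OF s] length_derivs]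
    gram_det_frame_derivs[OF s order_refl, symmetric]
  by (rule gram_det_cong[OF refl derivs_nth])

section \<open>The skew tridiagonal derivative matrix of the frame, and the curvatures\<close>

lemma frame_derivative:
  assumes t: "t \<in> {a..b}"
  defines "e' \<equiv> \<lambda>i. vector_derivative (e i) (at t within {a..b})"
  shows "\<And>i. i \<in> {1..DIM('a)} \<Longrightarrow> (e i has_vector_derivative e' i) (at t within {a..b})"
    and "\<And>i j. i \<in> {1..DIM('a)} \<Longrightarrow> j \<in> {1..DIM('a)} \<Longrightarrow>
      inner (e' i) (e j t) = - inner (e' j) (e i t)"
    and "\<And>i k. 1 \<le> i \<Longrightarrow> Suc i < k \<Longrightarrow> k \<le> DIM('a) \<Longrightarrow> inner (e' k) (e i t) = 0"
    and "\<And>r. 1 \<le> r \<Longrightarrow> r < DIM('a) \<Longrightarrow> inner (e' r) (e (Suc r) t) = R t (Suc r) / R t r"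
proof -
  let ?n = "DIM('a)"
  show e': "(e i has_vector_derivative e' i) (at t within {a..b})" if "i \<in> {1..?n}" for i
    using frame_differentiable[OF t that] unfolding e'_def vector_derivative_works .
  show skew: "inner (e' i) (e j t) = - inner (e' j) (e i t)" if "i \<in> {1..?n}" "j \<in> {1..?n}" for i j
    using vector_derivative_inner_const[OF interval t e'[OF that(1)] e'[OF that(2)] frame_inner[OF _ that]]
    by (simp add: inner_commute)
  have shift: "inner (e' k) (v t r) = - inner (v t (Suc r)) (e k t)"
    if "1 \<le> r" "r < k" "k \<le> ?n" for r k
  proof -
    have "inner (v t r) (e' k) + inner (v t (Suc r)) (e k t) = 0"
      using that t by (intro vector_derivative_inner_const[OF interval t
          has_vector_derivative_derivs e' derivs_inner_frame]) auto
    then show ?thesis by (simp add: inner_commute)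
  qed
  \<comment> \<open>\<open>e i t\<close> is a combination of the \<open>v t r\<close> with
    \<open>r \<le> i\<close>; for these \<open>Suc r < k\<close>, so the right-hand side of
    \<open>shift\<close> vanishes.\<close>
  show far: "inner (e' k) (e i t) = 0" if "1 \<le> i" "Suc i < k" "k \<le> ?n" for i k
  proof -
    have "inner (e i t) (e' k) = 0"
    proof (rule inner_span_zero)
      show "e i t \<in> span (v t ` {1..i})"
        using that by (subst frame_span[OF t, symmetric]) (auto intro: span_base)
      fix x assume "x \<in> v t ` {1..i}"
      then obtain r where "r \<in> {1..i}" "x = v t r" by blast
      then show "inner x (e' k) = 0"
        using shift[of r k] derivs_inner_frame[OF t, of "Suc r" k] that by (simp add: inner_commute)
    qed
    then show ?thesis by (simp add: inner_commute)
  qed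
  show "inner (e' r) (e (Suc r) t) = R t (Suc r) / R t r" if r: "1 \<le> r" "r < ?n" for r
  proof -
    have "inner (e' (Suc r)) (v t r)
        = inner (e' (Suc r)) (\<Sum>k<r. inner (v t r) (e (Suc k) t) *\<^sub>R e (Suc k) t)"
      using derivs_expand[OF t r, of r] r by simp
    also have "\<dots> = (\<Sum>k<r. inner (v t r) (e (Suc k) t) * inner (e' (Suc r)) (e (Suc k) t))"
      by (simp add: inner_sum_right)
    \<comment> \<open>In this sum counted from 0, index \<open>r - 1\<close> stands for
      \<open>e r t\<close>; the earlier frame vectors are orthogonal to \<open>e' (Suc r)\<close> by
      \<open>far\<close>.\<close>
    also have "\<dots> = (\<Sum>k\<in>{r - 1}. inner (v t r) (e (Suc k) t) * inner (e' (Suc r)) (e (Suc k) t))"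
      using r far by (intro sum.mono_neutral_right) auto
    also have "\<dots> = - (R t r * inner (e' r) (e (Suc r) t))"
      using r skew[of "Suc r" r] by (simp add: R_def)
    finally have "R t (Suc r) = R t r * inner (e' r) (e (Suc r) t)"
      using shift[of r "Suc r"] r unfolding R_def by simp
    then show ?thesis using R_pos[OF t r] by (simp add: field_simps)
  qed
qed

lemma curvature_eq:
  assumes t: "t \<in> {a..b}" and r: "1 \<le> r" "r < DIM('a)"
  shows "curvature \<O> a b c r t = R t (Suc r) / R t r / norm (v t 1)"
proof -
  let ?n = "DIM('a)"
  define e' where "e' i = vector_derivative (e i) (at t within {a..b})" for i
  note fd = frame_derivative[OF t, folded e'_def]
  define N where "N = norm (v t 1)"
  have "N > 0"
    using R_pos[OF t, of 1] dim_ge_2 unfolding R_def N_def by auto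
  \<comment> \<open>The values are forced by comparing coordinates along \<open>e (Suc i) t\<close>;
    zero outside the range matches the convention in \<open>frenet_serret_at\<close>.\<close>
  define \<kappa> where "\<kappa> i = (if i \<in> {1..<?n} then R t (Suc i) / R t i / N else 0)" for i
  \<comment> \<open>Computed for arbitrary coefficients \<open>k\<close>, so that it serves both
    existence and uniqueness. At the two ends of the frame the vanishing of \<open>k 0\<close> and
    \<open>k DIM('a)\<close> removes the meaningless neighbours.\<close>
  have inner_rhs: "inner (N *\<^sub>R (- k (i - 1) *\<^sub>R e (i - 1) t + k i *\<^sub>R e (i + 1) t)) (e j t)
      = (if i = Suc j then - N * k j else if j = Suc i then N * k i else 0)"
    if k: "\<forall>i. i \<notin> {1..<?n} \<longrightarrow> k i = (0::real)" and ij: "i \<in> {1..?n}" "j \<in> {1..?n}" for k i j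
  proof -
    have "k (i - 1) * inner (e (i - 1) t) (e j t) = (if i = Suc j then k j else 0)"
    proof (cases "i = 1")
      case True then show ?thesis using k ij by auto
    next
      case False
      then have "i - 1 \<in> {1..?n}" using ij by auto
      then show ?thesis using frame_inner[OF t _ ij(2)] False by auto
    qed
    moreover have "k i * inner (e (i + 1) t) (e j t) = (if j = Suc i then k i else 0)"
    proof (cases "i = ?n")
      case True then show ?thesis using k ij by auto
    next
      case False
      then have "i + 1 \<in> {1..?n}" using ij by auto
      then show ?thesis using frame_inner[OF t _ ij(2)] by auto
    qed
    ultimately show ?thesis
      by (simp only: inner_scaleR_left inner_add_left mult_minus_left) auto
  qed
  have deriv_inner: "inner (e' i) (e j t)
      = (if i = Suc j then - N * \<kappa> j else if j = Suc i then N * \<kappa> i else 0)"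
    if ij: "i \<in> {1..?n}" "j \<in> {1..?n}" for i j
  proof -
    consider "i = Suc j" | "j = Suc i" | "i = j" | "Suc j < i" | "Suc i < j" by linarith
    then show ?thesis
    proof cases
      case 1
      then show ?thesis using fd(2)[OF ij] fd(4)[of j] ij \<open>N > 0\<close> by (auto simp: \<kappa>_def)
    next
      case 2
      then show ?thesis using fd(4)[of i] ij \<open>N > 0\<close> by (auto simp: \<kappa>_def)
    next
      case 3
      then show ?thesis using fd(2)[OF ij] by simp
    next
      case 4
      then show ?thesis using fd(3)[of j i] ij by simp
    next
      case 5
      then show ?thesis using fd(2)[OF ij] fd(3)[of i j] ij by simp
    qed
  qed
  have zero: "\<forall>i. i \<notin> {1..<?n} \<longrightarrow> \<kappa> i = 0" by (simp add: \<kappa>_def)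
  have "frenet_serret_at \<O> a b c t \<kappa>"
    unfolding frenet_serret_at_def Let_def N_def[symmetric]
  proof (intro conjI ballI zero)
    fix i assume i: "i \<in> {1..?n}"
    have "e' i = N *\<^sub>R (- \<kappa> (i - 1) *\<^sub>R e (i - 1) t + \<kappa> i *\<^sub>R e (i + 1) t)"
    proof (rule orthonormal_eqI[OF frame_orthonormal(1)[OF t]])
      fix k assume "k < ?n"
      then have "Suc k \<in> {1..?n}" by simp
      then show "inner (e' i) (e (Suc k) t)
          = inner (N *\<^sub>R (- \<kappa> (i - 1) *\<^sub>R e (i - 1) t + \<kappa> i *\<^sub>R e (i + 1) t)) (e (Suc k) t)"
        unfolding inner_rhs[OF zero i \<open>Suc k \<in> {1..?n}\<close>] by (rule deriv_inner[OF i])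
    qed
    then show "(e i has_vector_derivative
        N *\<^sub>R (- \<kappa> (i - 1) *\<^sub>R e (i - 1) t + \<kappa> i *\<^sub>R e (i + 1) t)) (at t within {a..b})"
      using fd(1)[OF i] by simp
  qed
  \<comment> \<open>Uniqueness for the definite description: the coordinate along
    \<open>e (Suc i) t\<close> of the equation for \<open>e i\<close> determines \<open>k i\<close>,
    as \<open>N > 0\<close>.\<close>
  moreover have "k = \<kappa>" if k: "frenet_serret_at \<O> a b c t k" for k
  proof
    fix i
    note k' = k[unfolded frenet_serret_at_def Let_def N_def[symmetric]]
    show "k i = \<kappa> i"
    proof (cases "i \<in> {1..<?n}")
      case True
      then have i: "i \<in> {1..?n}" "Suc i \<in> {1..?n}" by auto
      have "e' i = N *\<^sub>R (- k (i - 1) *\<^sub>R e (i - 1) t + k i *\<^sub>R e (i + 1) t)"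
      proof (rule vector_derivative_unique_within_closed_interval[of a b t])
        show "(e i has_vector_derivative e' i) (at t within cbox a b)"
          using fd(1)[OF i(1)] by simp
        show "(e i has_vector_derivative
            N *\<^sub>R (- k (i - 1) *\<^sub>R e (i - 1) t + k i *\<^sub>R e (i + 1) t)) (at t within cbox a b)"
          using bspec[OF conjunct2[OF k'] i(1)] by (simp only: cbox_interval)
      qed (use interval t in auto)
      then have "inner (e' i) (e (Suc i) t) = N * k i"
        using inner_rhs[OF conjunct1[OF k'] i] by simp
      then show ?thesis using deriv_inner[OF i] \<open>N > 0\<close> by simp
    next
      case False
      then show ?thesis using conjunct1[OF k'] zero by simp
    qed
  qed
  ultimately have "(THE \<kappa>. frenet_serret_at \<O> a b c t \<kappa>) = \<kappa>" by (rule the_equality)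
  then show ?thesis unfolding curvature_def using r by (simp add: \<kappa>_def N_def)
qed

text \<open>The common factors cancel, and only coefficients with index at most \<open>r\<close>,
  all positive, are divided out. As \<open>r + 1\<close> may equal the dimension, the same quotient
  serves both identities.\<close>

lemma prod_R_quotient:
  assumes "t \<in> {a..b}" "1 \<le> r" "r < DIM('a)"
  shows "(\<Prod>i<r - 1. R t (Suc i)) * (\<Prod>i<r + 1. R t (Suc i)) / (\<Prod>i<r. R t (Suc i))\<^sup>2
    = R t (Suc r) / R t r"
proof -
  obtain q where q: "r = Suc q" using assms(2) by (cases r) auto
  have "(\<Prod>i<q. R t (Suc i)) \<noteq> 0"
    using R_pos[OF assms(1)] assms(3) q by (force simp: less_le)
  then show ?thesis
    using R_pos[OF assms] q by (simp add: power2_eq_square)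
qed

end

theorem theorem1:
  fixes c :: "real \<Rightarrow> 'a::euclidean_space"
    and \<O> :: "'a list set"
    and a b t :: real
  assumes "DIM('a) \<ge> 2"
    and "\<O> \<in> orientations"
    and "regular_curve a b c"
    and "t \<in> {a..b}"
  shows "(\<forall>r. 1 \<le> r \<and> r \<le> DIM('a) - 2 \<longrightarrow>
            curvature \<O> a b c r t =
              vol (derivs a b c (r - 1) t) * vol (derivs a b c (r + 1) t)
                / (vol (derivs a b c r t))\<^sup>2
                * inverse (norm (nth_derivative a b c 1 t))) \<and>
         curvature \<O> a b c (DIM('a) - 1) t =
           vol (derivs a b c (DIM('a) - 2) t) * oriented_det \<O> (derivs a b c (DIM('a)) t)
             / (vol (derivs a b c (DIM('a) - 1) t))\<^sup>2
             * inverse (norm (nth_derivative a b c 1 t))"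
proof -
  obtain \<sigma> where "\<sigma> = 1 \<or> \<sigma> = -1"
    "\<And>C. C \<in> \<O> \<longleftrightarrow> ordered_basis C \<and> \<sigma> * std_det (nth C) > 0"
    using orientation_sign[OF assms(2)] by blast
  then interpret frenet_curve \<O> \<sigma> a b c
    using assms(1,3) by unfold_locales
  show ?thesis
  proof (intro conjI allI impI)
    fix r assume "1 \<le> r \<and> r \<le> DIM('a) - 2"
    \<comment> \<open>Here \<open>r + 1\<close> stays below the dimension, so all three volumes fall
      under \<open>vol_derivs\<close>.\<close>
    then have r: "1 \<le> r" "r < DIM('a)" "r - 1 < DIM('a)" "r + 1 < DIM('a)" using assms(1) by auto
    show "curvature \<O> a b c r t =
        vol (derivs a b c (r - 1) t) * vol (derivs a b c (r + 1) t) / (vol (derivs a b c r t))\<^sup>2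
          * inverse (norm (nth_derivative a b c 1 t))"
      unfolding vol_derivs[OF assms(4) r(2)] vol_derivs[OF assms(4) r(3)]
        vol_derivs[OF assms(4) r(4)] prod_R_quotient[OF assms(4) r(1,2)]
        curvature_eq[OF assms(4) r(1,2)] by (rule divide_inverse)
  next
    \<comment> \<open>Now \<open>r + 1\<close> is the dimension; the product up to
      \<open>r + 1\<close> is the oriented determinant, which keeps the sign of the last
      coefficient.\<close>
    define r where "r = DIM('a) - 1"
    then have r: "1 \<le> r" "r < DIM('a)" "r - 1 < DIM('a)" and eq: "DIM('a) - 2 = r - 1" "DIM('a) = r + 1"
      using assms(1) by auto
    have "oriented_det \<O> (derivs a b c (DIM('a)) t) = (\<Prod>i<r + 1. R t (Suc i))"
      using oriented_det_derivs[OF assms(4)] eq(2) by simp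
    then show "curvature \<O> a b c (DIM('a) - 1) t =
        vol (derivs a b c (DIM('a) - 2) t) * oriented_det \<O> (derivs a b c (DIM('a)) t)
          / (vol (derivs a b c (DIM('a) - 1) t))\<^sup>2 * inverse (norm (nth_derivative a b c 1 t))"
      unfolding r_def[symmetric] eq(1) vol_derivs[OF assms(4) r(2)] vol_derivs[OF assms(4) r(3)]
        curvature_eq[OF assms(4) r(1,2)]
      by (simp only: prod_R_quotient[OF assms(4) r(1,2)]) (rule divide_inverse)
  qed
qed

end
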